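(* Let $A$, $\tilde M$ and $\hat M$ be $n\times n$ real matrices (all nonsingular) such that $$0\notin \mathcal{F}(A\tilde M^{-1})\cap\mathcal{F}(A\hat M^{-1}).$$ For an arbitrary initial guess $x^{(0)}$, let $x^{(\frac12)}$ and $x^{(1)}$ be computed by the first step of the TSTMR method, and let the subsequent iterates be computed by the TSTMR method (see the context). If $W_A(\delta^{(k)}_1,\delta^{(k)}_2)$ and $W_A(\delta^{(k+\frac12)}_1,\delta^{(k+\frac12)}_2)$ are nonsingular for $k=1,2,\ldots$, then the method is convergent, i.e. $\|r^{(k)}\|\to 0$ as $k\to\infty$, equivalently $x^{(k)}$ converges to the unique solution of $Ax=b$.
   Context: The field of values of $W\in\mathbb{R}^{n\times n}$ is $\mathcal{F}(W)=\{\langle Wy,y\rangle/\langle y,y\rangle : 0\ne y\in\mathbb{C}^n\}$, where $\langle x,y\rangle=x^*y$ is the Euclidean inner product; $\|\cdot\|$ is the Euclidean norm. Let $A\in\mathbb{R}^{n\times n}$ be nonsingular, $b\in\mathbb{R}^n$, and let $A=\tilde M-\tilde N=\hat M-\hat N$ be two splittings with $\tilde M,\hat M\in\mathbb{R}^{n\times n}$ nonsingular. For $x,y\in\mathbb{R}^n$ set $$W_A(x,y)=\begin{bmatrix}\langle Ax,Ax\rangle & \langle Ay,Ax\rangle\\ \langle Ax,Ay\rangle & \langle Ay,Ay\rangle\end{bmatrix}.$$ The TSTMR method for $Ax=b$. Given an arbitrary $x^{(0)}\in\mathbb{R}^n$, write $r^{(j)}=b-Ax^{(j)}$ and $r^{(j+\frac12)}=b-Ax^{(j+\frac12)}$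 for residuals, and for all $j\ge 0$ set $\delta_1^{(j)}=\tilde M^{-1}r^{(j)}$, $\delta_1^{(j+\frac12)}=\hat M^{-1}r^{(j+\frac12)}$; for $j\ge1$ set $\delta_2^{(j)}=\delta_1^{(j)}-\delta_1^{(j-1)}$ and $\delta_2^{(j+\frac12)}=\delta_1^{(j+\frac12)}-\delta_1^{((j-1)+\frac12)}$. First step: $x^{(\frac12)}=x^{(0)}+\beta_0\delta_1^{(0)}$ and $x^{(1)}=x^{(\frac12)}+\gamma_0\delta_1^{(\frac12)}$ with $$\beta_0=\frac{\langle r^{(0)},A\delta_1^{(0)}\rangle}{\|A\delta_1^{(0)}\|^2},\qquad \gamma_0=\frac{\langle r^{(\frac12)},A\delta_1^{(\frac12)}\rangle}{\|A\delta_1^{(\frac12)}\|^2}$$ (it is understood that $r^{(0)}$ and $r^{(\frac12)}$ are nonzero, so that these are defined). For $j\ge1$: $x^{(j+\frac12)}=x^{(j)}+\beta_1^{(j)}\delta_1^{(j)}+\beta_2^{(j)}\delta_2^{(j)}$ and $x^{(j+1)}=x^{(j+\frac12)}+\gamma_1^{(j)}\delta_1^{(j+\frac12)}+\gamma_2^{(j)}\delta_2^{(j+\frac12)}$, where the coefficients solve $$W_A(\delta_1^{(j)},\delta_2^{(j)})\begin{bmatrix}\beta_1^{(j)}\\ \beta_2^{(j)}\end{bmatrix}=\begin{bmatrix}\langle r^{(j)},A\delta_1^{(j)}\rangle\\ \langle r^{(j)},A\delta_2^{(j)}\rangle\end{bmatrix},\qquad W_A(\delta_1^{(j+\frac12)},\delta_2^{(j+\frac12)})\begin{bmatrix}\gamma_1^{(j)}\\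 \gamma_2^{(j)}\end{bmatrix}=\begin{bmatrix}\langle r^{(j+\frac12)},A\delta_1^{(j+\frac12)}\rangle\\ \langle r^{(j+\frac12)},A\delta_2^{(j+\frac12)}\rangle\end{bmatrix}.$$ *)

theory Defs
  imports "HOL-Analysis.Analysis"
begin

text \<open>The Euclidean inner product on complex vectors, conjugate-linear in the first argument
  (the library's \<open>inner\<close> on \<open>complex ^ 'n\<close> is only its real part).\<close>

definition cinner_vec :: "complex ^ 'n \<Rightarrow> complex ^ 'n \<Rightarrow> complex" where
  "cinner_vec x y = (\<Sum>i\<in>UNIV. cnj (x $ i) * y $ i)"

definition field_of_values :: "real ^ 'n ^ 'n \<Rightarrow> complex set" where
  "field_of_values W =
     {cinner_vec (map_matrix complex_of_real W *v y) y / cinner_vec y y | y. y \<noteq> 0}"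

definition residual :: "real ^ 'n ^ 'n \<Rightarrow> real ^ 'n \<Rightarrow> real ^ 'n \<Rightarrow> real ^ 'n" where
  "residual A b x = b - A *v x"

definition W_mat :: "real ^ 'n ^ 'n \<Rightarrow> real ^ 'n \<Rightarrow> real ^ 'n \<Rightarrow> real ^ 2 ^ 2" where
  "W_mat A x y = vector
     [vector [(A *v x) \<bullet> (A *v x), (A *v y) \<bullet> (A *v x)],
      vector [(A *v x) \<bullet> (A *v y), (A *v y) \<bullet> (A *v y)]]"

text \<open>A run of the method is given by two sequences, \<open>x\<close> for the iterates with integer index and
  \<open>xh\<close> for those with half-integer index: \<open>xh j\<close> is the iterate with index \<open>j + 1/2\<close>.
  The corrections at integer indices are obtained from \<open>(Mt, x)\<close> and those at half-integer
  indices from \<open>(Mh, xh)\<close>. \<open>delta2\<close> is only meaningful for \<open>j \<ge> 1\<close>.\<close>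

definition delta1 ::
  "real ^ 'n ^ 'n \<Rightarrow> real ^ 'n \<Rightarrow> real ^ 'n ^ 'n \<Rightarrow> (nat \<Rightarrow> real ^ 'n) \<Rightarrow> nat \<Rightarrow> real ^ 'n" where
  "delta1 A b M x j = matrix_inv M *v residual A b (x j)"

definition delta2 ::
  "real ^ 'n ^ 'n \<Rightarrow> real ^ 'n \<Rightarrow> real ^ 'n ^ 'n \<Rightarrow> (nat \<Rightarrow> real ^ 'n) \<Rightarrow> nat \<Rightarrow> real ^ 'n" where
  "delta2 A b M x j = delta1 A b M x j - delta1 A b M x (j - 1)"

definition one_param_step ::
  "real ^ 'n ^ 'n \<Rightarrow> real ^ 'n \<Rightarrow> real ^ 'n \<Rightarrow> real ^ 'n \<Rightarrow> real ^ 'n" where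
  "one_param_step A b d u =
     u + ((residual A b u \<bullet> (A *v d)) / (norm (A *v d))\<^sup>2) *\<^sub>R d"

text \<open>The step is a relation between the old iterate \<open>u\<close> and the new iterate \<open>v\<close>, because the
  coefficient vector is specified as a solution of a linear system; it is unique when
  \<open>W_mat A d1 d2\<close> is invertible.\<close>

definition two_param_step ::
  "real ^ 'n ^ 'n \<Rightarrow> real ^ 'n \<Rightarrow> real ^ 'n \<Rightarrow> real ^ 'n \<Rightarrow> real ^ 'n \<Rightarrow> real ^ 'n \<Rightarrow> bool" where
  "two_param_step A b d1 d2 u v \<longleftrightarrow>
     (\<exists>c :: real ^ 2.
        W_mat A d1 d2 *v c =
          vector [residual A b u \<bullet> (A *v d1), residual A b u \<bullet> (A *v d2)] \<and>
        v = u + (c $ 1) *\<^sub>R d1 + (c $ 2) *\<^sub>R d2)"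

definition TSTMR ::
  "real ^ 'n ^ 'n \<Rightarrow> real ^ 'n \<Rightarrow> real ^ 'n ^ 'n \<Rightarrow> real ^ 'n ^ 'n \<Rightarrow> real ^ 'n \<Rightarrow>
   (nat \<Rightarrow> real ^ 'n) \<Rightarrow> (nat \<Rightarrow> real ^ 'n) \<Rightarrow> bool" where
  "TSTMR A b Mt Mh x0 x xh \<longleftrightarrow>
     x 0 = x0 \<and>
     xh 0 = one_param_step A b (delta1 A b Mt x 0) (x 0) \<and>
     x 1 = one_param_step A b (delta1 A b Mh xh 0) (xh 0) \<and>
     (\<forall>j\<ge>1.
        two_param_step A b (delta1 A b Mt x j) (delta2 A b Mt x j) (x j) (xh j) \<and>
        two_param_step A b (delta1 A b Mh xh j) (delta2 A b Mh xh j) (xh j) (x (j + 1)))"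

end

theory Submission
  imports Defs
begin

text \<open>Each half step \<open>j \<ge> 1\<close> makes the new residual orthogonal to the images under \<open>A\<close> of both
  corrections, so it does at least as well as the optimal one-parameter step along \<open>\<delta>\<^sub>1\<close>, whose
  squared residual is \<open>\<parallel>r\<parallel>\<^sup>2 - (r \<bullet> P r)\<^sup>2 / \<parallel>P r\<parallel>\<^sup>2\<close> with \<open>P = A M\<^sup>-\<^sup>1\<close>. If \<open>0\<close> is not in the field of
  values of \<open>P\<close>, compactness of the unit sphere bounds this by a fixed multiple \<open>q\<^sup>2 < 1\<close> of
  \<open>\<parallel>r\<parallel>\<^sup>2\<close>. By hypothesis this happens for one of the two splittings, and the half step of the other
  one does not increase the residual.\<close>

text \<open>Residuals are real, so the complex field of values enters only through Rayleigh
  quotients of real vectors, embedded componentwise. If it omits 0, the real quadratic form of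
  \<open>W\<close> vanishes only at 0.\<close>

lemma inner_in_field_of_values:
  fixes W :: "real ^ 'n ^ 'n" and y :: "real ^ 'n"
  assumes "y \<noteq> 0"
  shows "complex_of_real (y \<bullet> (W *v y) / (y \<bullet> y)) \<in> field_of_values W"
proof -
  define z :: "complex ^ 'n" where "z = (\<chi> i. complex_of_real (y $ i))"
  have "z \<noteq> 0"
    using assms by (auto simp: z_def vec_eq_iff)
  have Wz: "(map_matrix complex_of_real W *v z) $ i = complex_of_real ((W *v y) $ i)" for i
    by (simp add: z_def map_matrix_def matrix_vector_mult_def)
  have num: "cinner_vec (map_matrix complex_of_real W *v z) z = complex_of_real (y \<bullet> (W *v y))"
    unfolding cinner_vec_def Wz by (simp add: z_def inner_vec_def mult.commute)
  have den: "cinner_vec z z = complex_of_real (y \<bullet> y)"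
    by (simp add: cinner_vec_def z_def inner_vec_def)
  show ?thesis
    unfolding field_of_values_def using \<open>z \<noteq> 0\<close>
    by (intro CollectI exI[of _ z]) (simp add: num den)
qed

text \<open>The constant is the minimum of the continuous function \<open>?f\<close> on the compact
  unit sphere, attained at some \<open>u\<close> and hence positive. Homogeneity of degree 2 carries
  the bound to all vectors.\<close>

lemma inner_mult_bounded_below:
  fixes P :: "real ^ 'n ^ 'n"
  assumes "0 \<notin> field_of_values P"
  obtains c where "c > 0" "\<And>y. c * (norm y)\<^sup>2 \<le> \<bar>y \<bullet> (P *v y)\<bar>"
proof -
  let ?f = "\<lambda>y. \<bar>y \<bullet> (P *v y)\<bar>"
  let ?S = "sphere (0 :: real ^ 'n) 1"
  have cont: "continuous_on ?S ?f"
    by (intro continuous_intros linear_continuous_on matrix_vector_mul_bounded_linear)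
  have "?S \<noteq> {}"
    by simp
  then obtain u where u: "u \<in> ?S" and min: "\<And>y. y \<in> ?S \<Longrightarrow> ?f u \<le> ?f y"
    using continuous_attains_inf[OF compact_sphere _ cont] by blast
  have "u \<noteq> 0"
    using u by auto
  then have "?f u > 0"
    using inner_in_field_of_values[of u P] assms by (metis div_0 of_real_0 zero_less_abs_iff)
  moreover have "?f u * (norm y)\<^sup>2 \<le> ?f y" for y
  proof (cases "y = 0")
    case False
    define e where "e = y /\<^sub>R norm y"
    have "e \<in> ?S"
      using False by (simp add: e_def)
    have "?f (norm y *\<^sub>R e) = (norm y)\<^sup>2 * ?f e"
      by (simp add: matrix_vector_mult_scaleR abs_mult power2_eq_square)
    then have "?f y = (norm y)\<^sup>2 * ?f e"
      using False by (simp add: e_def)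
    then show ?thesis
      using mult_left_mono[OF min[OF \<open>e \<in> ?S\<close>], of "(norm y)\<^sup>2"] by (simp add: mult.commute)
  qed simp
  ultimately show thesis
    using that by blast
qed

lemma optimal_step_contraction:
  fixes P :: "real ^ 'n ^ 'n"
  assumes "0 \<notin> field_of_values P"
  obtains q where "0 \<le> q" "q < 1" "\<And>r. \<exists>t. norm (r - t *\<^sub>R (P *v r)) \<le> q * norm r"
proof -
  obtain c where c: "c > 0" "\<And>y. c * (norm y)\<^sup>2 \<le> \<bar>y \<bullet> (P *v y)\<bar>"
    using inner_mult_bounded_below[OF assms] by blast
  obtain K where K: "K > 0" "\<And>y. norm (P *v y) \<le> norm y * K"
    using bounded_linear.pos_bounded[OF matrix_vector_mul_bounded_linear[of P]] by blast
  \<comment> \<open>The coefficient minimises the norm along the line. The factor comes from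
    \<open>\<bar>r \<bullet> P r\<bar> \<ge> c \<parallel>r\<parallel>^2\<close> and
    \<open>\<parallel>P r\<parallel> \<le> K \<parallel>r\<parallel>\<close>; \<open>max 0\<close>
    keeps the radicand nonnegative without comparing \<open>c\<close> and \<open>K\<close>.\<close>
  have bound: "norm (r - ((r \<bullet> (P *v r)) / (norm (P *v r))\<^sup>2) *\<^sub>R (P *v r))
      \<le> sqrt (max 0 (1 - c\<^sup>2 / K\<^sup>2)) * norm r" for r
  proof (cases "r = 0")
    case False
    define p where "p = P *v r"
    have cr: "c * (norm r)\<^sup>2 \<le> \<bar>r \<bullet> p\<bar>"
      using c(2) by (simp add: p_def)
    have "0 < c * (norm r)\<^sup>2"
      using c(1) False by simp
    \<comment> \<open>The positive lower bound on \<open>\<bar>r \<bullet> p\<bar>\<close> rules out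
      \<open>p = 0\<close>, so the divisions by \<open>(norm p)^2\<close> below are genuine.\<close>
    then have "p \<noteq> 0"
      using cr by auto
    have "(norm (r - ((r \<bullet> p) / (norm p)\<^sup>2) *\<^sub>R p))\<^sup>2 = (norm r)\<^sup>2 - (r \<bullet> p)\<^sup>2 / (norm p)\<^sup>2"
    proof -
      have pp: "(norm p)\<^sup>2 \<noteq> 0"
        using \<open>p \<noteq> 0\<close> by simp
      have "(norm (r - s *\<^sub>R p))\<^sup>2 = (norm r)\<^sup>2 - 2 * s * (r \<bullet> p) + s\<^sup>2 * (norm p)\<^sup>2" for s
        unfolding power2_norm_eq_inner
        by (simp add: inner_diff inner_commute power2_eq_square algebra_simps)
      then have "(norm (r - (a / n) *\<^sub>R p))\<^sup>2 = (norm r)\<^sup>2 - a\<^sup>2 / n"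
        if "a = r \<bullet> p" "n = (norm p)\<^sup>2" for a n
        using pp unfolding that[symmetric] by (simp add: power2_eq_square)
      then show ?thesis
        by simp
    qed
    also have "\<dots> \<le> (norm r)\<^sup>2 - (c / K)\<^sup>2 * (norm r)\<^sup>2"
    proof -
      have "(c * (norm r)\<^sup>2)\<^sup>2 / (norm r * K)\<^sup>2 \<le> (r \<bullet> p)\<^sup>2 / (norm p)\<^sup>2"
      proof (rule frac_le)
        show "(c * (norm r)\<^sup>2)\<^sup>2 \<le> (r \<bullet> p)\<^sup>2"
          using power_mono[OF cr, of 2] c(1) by simp
        show "(norm p)\<^sup>2 \<le> (norm r * K)\<^sup>2"
          using K(2)[of r] by (intro power_mono) (auto simp: p_def)
      qed (use \<open>p \<noteq> 0\<close> in auto)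
      moreover have "(c * (norm r)\<^sup>2)\<^sup>2 / (norm r * K)\<^sup>2 = (c / K)\<^sup>2 * (norm r)\<^sup>2"
        using False K(1) by (simp add: field_simps power2_eq_square)
      ultimately show ?thesis
        by simp
    qed
    also have "\<dots> = (1 - c\<^sup>2 / K\<^sup>2) * (norm r)\<^sup>2"
      by (simp add: power_divide left_diff_distrib)
    also have "\<dots> \<le> max 0 (1 - c\<^sup>2 / K\<^sup>2) * (norm r)\<^sup>2"
      by (intro mult_right_mono) auto
    finally have "sqrt ((norm (r - ((r \<bullet> p) / (norm p)\<^sup>2) *\<^sub>R p))\<^sup>2)
        \<le> sqrt (max 0 (1 - c\<^sup>2 / K\<^sup>2) * (norm r)\<^sup>2)"
      by (rule real_sqrt_le_mono)
    then show ?thesis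
      by (simp add: p_def real_sqrt_mult)
  qed simp
  show thesis
  proof (rule that)
    show "sqrt (max 0 (1 - c\<^sup>2 / K\<^sup>2)) < 1"
      using c(1) K(1) by simp
    show "\<exists>t. norm (r - t *\<^sub>R (P *v r)) \<le> sqrt (max 0 (1 - c\<^sup>2 / K\<^sup>2)) * norm r" for r
      using bound by blast
  qed simp
qed

text \<open>The linear system is the system of normal equations for least squares over the span of
  \<open>A *v d1\<close> and \<open>A *v d2\<close>; every one-parameter step along
  \<open>d1\<close> is a competitor in that problem.\<close>

lemma residual_two_param_step_le:
  assumes "two_param_step A b d1 d2 u v"
  shows "norm (residual A b v) \<le> norm (residual A b u - t *\<^sub>R (A *v d1))"
proof -
  obtain c :: "real ^ 2" where
    c: "W_mat A d1 d2 *v c = vector [residual A b u \<bullet> (A *v d1), residual A b u \<bullet> (A *v d2)]"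
    and v: "v = u + (c $ 1) *\<^sub>R d1 + (c $ 2) *\<^sub>R d2"
    using assms unfolding two_param_step_def by blast
  define r s p1 p2 where "r = residual A b u" and "s = residual A b v"
    and "p1 = A *v d1" and "p2 = A *v d2"
  have s: "s = r - (c $ 1) *\<^sub>R p1 - (c $ 2) *\<^sub>R p2"
    unfolding s_def r_def p1_def p2_def v residual_def
    by (simp add: matrix_vector_right_distrib matrix_vector_mult_scaleR)
  have W: "W_mat A d1 d2 = vector [vector [p1 \<bullet> p1, p2 \<bullet> p1], vector [p1 \<bullet> p2, p2 \<bullet> p2]]"
    by (simp add: W_mat_def p1_def p2_def)
  have "(W_mat A d1 d2 *v c) $ 1 = r \<bullet> p1"
    unfolding c r_def p1_def by simp
  then have "r \<bullet> p1 = c $ 1 * (p1 \<bullet> p1) + c $ 2 * (p2 \<bullet> p1)"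
    unfolding W matrix_vector_mult_def sum_2 by (simp only: vec_lambda_beta vector_2 mult.commute)
  then have orth1: "s \<bullet> p1 = 0"
    unfolding s by (simp add: inner_diff_left)
  have "(W_mat A d1 d2 *v c) $ 2 = r \<bullet> p2"
    unfolding c r_def p2_def by simp
  then have "r \<bullet> p2 = c $ 1 * (p1 \<bullet> p2) + c $ 2 * (p2 \<bullet> p2)"
    unfolding W matrix_vector_mult_def sum_2 by (simp only: vec_lambda_beta vector_2 mult.commute)
  then have orth2: "s \<bullet> p2 = 0"
    unfolding s by (simp add: inner_diff_left)
  \<comment> \<open>The gap between the competitor and the new residual lies in the span of
    \<open>p1\<close> and \<open>p2\<close>, hence is orthogonal to \<open>s\<close>, and Pythagoras
    applies.\<close>
  define w where "w = (c $ 1 - t) *\<^sub>R p1 + (c $ 2) *\<^sub>R p2"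
  have "r - t *\<^sub>R p1 = s + w"
    by (simp add: s w_def algebra_simps)
  moreover have "s \<bullet> w = 0"
    by (simp add: w_def inner_add_right orth1 orth2)
  then have "(norm (s + w))\<^sup>2 = (norm s)\<^sup>2 + (norm w)\<^sup>2"
    by (intro norm_add_Pythagorean) (simp add: orthogonal_def)
  then have "norm s \<le> norm (s + w)"
    by (simp add: power2_le_imp_le)
  ultimately show ?thesis
    by (simp add: r_def s_def p1_def)
qed

corollary residual_two_param_step_mono:
  assumes "two_param_step A b d1 d2 u v"
  shows "norm (residual A b v) \<le> norm (residual A b u)"
  \<comment> \<open>The competitor \<open>t = 0\<close> leaves the iterate unchanged.\<close>
  using residual_two_param_step_le[OF assms, of 0] by simp

text \<open>The image under \<open>A\<close> of the first correction is
  \<open>A ** matrix_inv M\<close> applied to the residual, so the optimal one-parameter step is a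
  competitor. Since \<open>q\<close> is fixed before the iterates, one constant serves all
  steps.\<close>

lemma residual_two_param_step_contraction:
  fixes A M :: "real ^ 'n ^ 'n"
  assumes "0 \<notin> field_of_values (A ** matrix_inv M)"
  obtains q where "0 \<le> q" "q < 1"
    "\<And>b y j d2 v. two_param_step A b (delta1 A b M y j) d2 (y j) v \<Longrightarrow>
       norm (residual A b v) \<le> q * norm (residual A b (y j))"
proof -
  obtain q where q: "0 \<le> q" "q < 1"
    "\<And>r. \<exists>t. norm (r - t *\<^sub>R ((A ** matrix_inv M) *v r)) \<le> q * norm r"
    using optimal_step_contraction[OF assms] by blast
  show thesis
  proof (rule that[OF q(1,2)])
    fix b y j d2 v
    assume "two_param_step A b (delta1 A b M y j) d2 (y j) v"
    note le = residual_two_param_step_le[OF this]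
    obtain t where
      "norm (residual A b (y j) - t *\<^sub>R ((A ** matrix_inv M) *v residual A b (y j)))
        \<le> q * norm (residual A b (y j))"
      using q(3) by blast
    then show "norm (residual A b v) \<le> q * norm (residual A b (y j))"
      using le[of t] by (simp add: delta1_def matrix_vector_mul_assoc)
  qed
qed

text \<open>The error is the image of the residual under the continuous map
  \<open>matrix_inv A\<close>, so it vanishes with the residual.\<close>

lemma tendsto_solution_of_residual:
  assumes "invertible A" and "(\<lambda>k. norm (residual A b (x k))) \<longlonglongrightarrow> 0"
  shows "\<exists>!z. A *v z = b" and "x \<longlonglongrightarrow> (THE z. A *v z = b)"
proof -
  let ?z = "matrix_inv A *v b"
  have left: "matrix_inv A ** A = mat 1" and right: "A ** matrix_inv A = mat 1"
    using someI_ex[OF assms(1)[unfolded invertible_def]] by (simp_all add: matrix_inv_def)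
  have cancel: "matrix_inv A *v (A *v y) = y" for y
    by (simp add: matrix_vector_mul_assoc left)
  have z: "A *v ?z = b"
    by (simp add: matrix_vector_mul_assoc right)
  have uniq: "y = ?z" if "A *v y = b" for y
    using cancel[of y] that by simp
  show "\<exists>!z. A *v z = b"
    using z uniq by blast
  have the: "(THE z. A *v z = b) = ?z"
    using z uniq by blast
  have "(\<lambda>k. residual A b (x k)) \<longlonglongrightarrow> 0"
    using assms(2) by (simp add: tendsto_norm_zero_iff)
  then have "(\<lambda>k. ?z - matrix_inv A *v residual A b (x k)) \<longlonglongrightarrow> ?z - matrix_inv A *v 0"
    by (intro tendsto_intros bounded_linear.tendsto[OF matrix_vector_mul_bounded_linear])
  moreover have "?z - matrix_inv A *v residual A b (x k) = x k" for k
    by (simp add: residual_def matrix_vector_mult_diff_distrib cancel)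
  ultimately show "x \<longlonglongrightarrow> (THE z. A *v z = b)"
    by (simp add: the)
qed

lemma eventually_contractive_tendsto_zero:
  fixes f :: "nat \<Rightarrow> real"
  assumes "0 \<le> q" "q < 1" and nonneg: "\<And>k. 0 \<le> f k"
    and step: "\<And>k. k \<ge> m \<Longrightarrow> f (Suc k) \<le> q * f k"
  shows "f \<longlonglongrightarrow> 0"
proof -
  \<comment> \<open>The contraction is available only from \<open>m\<close> on, so geometric decay
    is measured from \<open>f m\<close> and the shift is undone at the end.\<close>
  have le: "f (k + m) \<le> q ^ k * f m" for k
  proof (induction k)
    case (Suc k)
    show ?case
      using order_trans[OF step[of "k + m"] mult_left_mono[OF Suc \<open>0 \<le> q\<close>]] by (simp add: mult_ac)
  qed simp
  have "(\<lambda>k. q ^ k * f m) \<longlonglongrightarrow> 0"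
    using LIMSEQ_realpow_zero[OF assms(1,2)] by (rule tendsto_mult_left_zero)
  then have "(\<lambda>k. f (k + m)) \<longlonglongrightarrow> 0"
    by (rule tendsto_sandwich[rotated 2, OF tendsto_const]) (use nonneg le in auto)
  then show ?thesis
    by (rule LIMSEQ_offset)
qed

theorem theorem2p8:
  fixes A Mt Nt Mh Nh :: "real ^ 'n ^ 'n"
    and b x0 :: "real ^ 'n"
    and x xh :: "nat \<Rightarrow> real ^ 'n"
  assumes "invertible A" and "invertible Mt" and "invertible Mh"
    and "A = Mt - Nt" and "A = Mh - Nh"
    and "0 \<notin> field_of_values (A ** matrix_inv Mt) \<inter> field_of_values (A ** matrix_inv Mh)"
    and "TSTMR A b Mt Mh x0 x xh"
    and "residual A b (x 0) \<noteq> 0" and "residual A b (xh 0) \<noteq> 0"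
    and "\<And>k. k \<ge> 1 \<Longrightarrow> invertible (W_mat A (delta1 A b Mt x k) (delta2 A b Mt x k))"
    and "\<And>k. k \<ge> 1 \<Longrightarrow> invertible (W_mat A (delta1 A b Mh xh k) (delta2 A b Mh xh k))"
  shows "(\<lambda>k. norm (residual A b (x k))) \<longlonglongrightarrow> 0 \<and>
         (\<exists>!z. A *v z = b) \<and> x \<longlonglongrightarrow> (THE z. A *v z = b)"
proof -
  have step_t: "two_param_step A b (delta1 A b Mt x j) (delta2 A b Mt x j) (x j) (xh j)"
    and step_h: "two_param_step A b (delta1 A b Mh xh j) (delta2 A b Mh xh j) (xh j) (x (Suc j))"
    if "j \<ge> 1" for j
    using \<open>TSTMR A b Mt Mh x0 x xh\<close> that by (auto simp: TSTMR_def)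
  let ?r = "\<lambda>k. norm (residual A b (x k))"
  \<comment> \<open>One full cycle consists of a half step with \<open>Mt\<close> followed by one
    with \<open>Mh\<close>; it suffices that one of them contracts.\<close>
  obtain q where q: "0 \<le> q" "q < 1" "\<And>k. k \<ge> 1 \<Longrightarrow> ?r (Suc k) \<le> q * ?r k"
  proof (cases "0 \<in> field_of_values (A ** matrix_inv Mt)")
    case False
    then obtain q where q: "0 \<le> q" "q < 1"
      "\<And>b y j d2 v. two_param_step A b (delta1 A b Mt y j) d2 (y j) v \<Longrightarrow>
         norm (residual A b v) \<le> q * norm (residual A b (y j))"
      by (rule residual_two_param_step_contraction) blast
    \<comment> \<open>The half step with \<open>Mt\<close> contracts first, and the one with
      \<open>Mh\<close> preserves the bound.\<close>
    show thesis
      by (rule that[OF q(1,2)])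
        (rule order_trans[OF residual_two_param_step_mono[OF step_h] q(3)[OF step_t]])
  next
    case True
    then have "0 \<notin> field_of_values (A ** matrix_inv Mh)"
      using assms(6) by blast
    then obtain q where q: "0 \<le> q" "q < 1"
      "\<And>b y j d2 v. two_param_step A b (delta1 A b Mh y j) d2 (y j) v \<Longrightarrow>
         norm (residual A b v) \<le> q * norm (residual A b (y j))"
      by (rule residual_two_param_step_contraction) blast
    \<comment> \<open>Here the contraction comes second: it is applied to \<open>xh k\<close>, whose
      residual is at most that of \<open>x k\<close>.\<close>
    show thesis
      by (rule that[OF q(1,2)])
        (rule order_trans[OF q(3)[OF step_h] mult_left_mono[OF residual_two_param_step_mono[OF step_t] q(1)]])
  qed
  \<comment> \<open>Two-parameter steps begin at index 1; the initial cycle only supplies the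
    starting value \<open>?r 1\<close>.\<close>
  have "?r \<longlonglongrightarrow> 0"
    by (rule eventually_contractive_tendsto_zero[where m = 1, OF q(1,2)]) (use q(3) in auto)
  then show ?thesis
    using tendsto_solution_of_residual[OF \<open>invertible A\<close>] by simp
qed

end
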